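(* Let $M\ge 1$ and $N=\{1,\dots,M\}$. The Layer 1 attribution values $\phi_j(f)$, $j\in N$, of functions $f:\mathcal{P}(N)\to\mathbb{R}$, satisfy the following three properties. 1. (Linearity) For all $f_1,f_2:\mathcal{P}(N)\to\mathbb{R}$, all $\alpha_1,\alpha_2\in\mathbb{R}$ and all $j\in N$, $$\phi_j(\alpha_1f_1+\alpha_2f_2)=\alpha_1\phi_j(f_1)+\alpha_2\phi_j(f_2).$$ 2. (Symmetry) For all $f:\mathcal{P}(N)\to\mathbb{R}$ and all $j,k\in N$: if $f(S\cup\{j\})=f(S\cup\{k\})$ for every $S\subseteq N$ with $j,k\notin S$, then $\phi_j(f)=\phi_k(f)$. 3. (Efficiency) For all $f:\mathcal{P}(N)\to\mathbb{R}$, $\sum_{i=1}^M\phi_i(f)=f(N)-f(\emptyset)$.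
   Context: $N$ is a set of $M$ features, and $f(S)$ is the value that the model being explained, at a fixed instance $x$, takes on the coalition $S\subseteq N$ of present features. The Layer 1 attribution value of feature $j\in N$ for $f$ is $$\phi_j(f)=\tilde\phi_j(f)+\frac{1}{M}\left(f(N)-f(\emptyset)-\sum_{i=1}^M\tilde\phi_i(f)\right),$$ where, for every $i\in N$, $$\tilde\phi_i(f)=\frac{f(\{i\})-f(\emptyset)+f(N)-f(N\setminus\{i\})}{2}.$$ Linear combinations of functions on $\mathcal{P}(N)$ are taken pointwise. *)

theory Defs
  imports Complex_Main
begin

(* A function on the power set of {1..M} is represented by a total function on nat set;
   for a feature j in {1..M}, layer1 M f j depends only on its values at subsets of {1..M}. *)

abbreviation features :: "nat \<Rightarrow> nat set" where
  "features M \<equiv> {1..M}"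

definition layer1_raw :: "nat \<Rightarrow> (nat set \<Rightarrow> real) \<Rightarrow> nat \<Rightarrow> real" where
  "layer1_raw M f i =
     (f {i} - f {} + f (features M) - f (features M - {i})) / 2"

definition layer1 :: "nat \<Rightarrow> (nat set \<Rightarrow> real) \<Rightarrow> nat \<Rightarrow> real" where
  "layer1 M f j =
     layer1_raw M f j
       + (1 / real M) * (f (features M) - f {} - (\<Sum>i = 1..M. layer1_raw M f i))"

end

theory Submission
  imports Defs
begin

text \<open>Each value is a raw score plus a correction common to all features: an equal share of
  the gap between \<open>f (features M) - f {}\<close> and the total of the raw scores. Raw scores
  and gap are fixed linear combinations of values of \<open>f\<close>, which gives
  \<open>layer1_linear\<close>. As the correction does not depend on the feature,
  \<open>layer1_symmetric\<close> reduces to equality of two raw scores. Summing the shares adds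
  back exactly the gap, which is \<open>layer1_efficient\<close>.\<close>

lemma layer1_raw_linear:
  "layer1_raw M (\<lambda>S. a * f S + b * g S) i = a * layer1_raw M f i + b * layer1_raw M g i"
  by (simp add: layer1_raw_def field_simps)

lemma layer1_linear:
  "layer1 M (\<lambda>S. a * f S + b * g S) j = a * layer1 M f j + b * layer1 M g j"
proof -
  have "(\<Sum>i = 1..M. layer1_raw M (\<lambda>S. a * f S + b * g S) i)
      = a * (\<Sum>i = 1..M. layer1_raw M f i) + b * (\<Sum>i = 1..M. layer1_raw M g i)"
    by (simp add: layer1_raw_linear sum.distrib sum_distrib_left)
  then show ?thesis
    unfolding layer1_def layer1_raw_linear by (simp add: algebra_simps)
qed

text \<open>Two coalitions suffice: \<open>S = {}\<close> matches the singleton terms, and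
  \<open>S = features M - {j, k}\<close> matches the leave-one-out terms.\<close>

lemma layer1_symmetric:
  assumes "j \<in> features M" "k \<in> features M"
    and eq: "\<And>S. S \<subseteq> features M \<Longrightarrow> j \<notin> S \<Longrightarrow> k \<notin> S \<Longrightarrow> f (S \<union> {j}) = f (S \<union> {k})"
  shows "layer1 M f j = layer1 M f k"
proof (cases "j = k")
  case False
  have "f {j} = f {k}"
    using eq[of "{}"] by simp
  moreover have "f (features M - {k}) = f (features M - {j})"
  proof -
    \<comment> \<open>The roles cross over: adding \<open>j\<close> leaves only \<open>k\<close>
      out. For \<open>j = k\<close> this would give all of \<open>features M\<close>, hence the case
      split.\<close>
    have "(features M - {j, k}) \<union> {j} = features M - {k}"
         "(features M - {j, k}) \<union> {k} = features M - {j}"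
      using assms(1,2) False by blast+
    then show ?thesis
      using eq[of "features M - {j, k}"] by simp
  qed
  ultimately show ?thesis
    by (simp add: layer1_def layer1_raw_def)
qed simp

text \<open>The correction is summed \<open>M\<close> times, and \<open>M \<ge> 1\<close> lets the
  factor \<open>1 / real M\<close> cancel; the raw scores then drop out.\<close>

lemma layer1_efficient:
  assumes "M \<ge> 1"
  shows "(\<Sum>i = 1..M. layer1 M f i) = f (features M) - f {}"
  using assms by (simp add: layer1_def sum.distrib)

theorem mainTheorem2:
  fixes M :: nat
  assumes "M \<ge> 1"
  shows
    "(\<forall>(f1 :: nat set \<Rightarrow> real) (f2 :: nat set \<Rightarrow> real) (\<alpha>1 :: real) (\<alpha>2 :: real).
        \<forall>j \<in> features M.
          layer1 M (\<lambda>S. \<alpha>1 * f1 S + \<alpha>2 * f2 S) j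
            = \<alpha>1 * layer1 M f1 j + \<alpha>2 * layer1 M f2 j)
     \<and> (\<forall>f :: nat set \<Rightarrow> real. \<forall>j \<in> features M. \<forall>k \<in> features M.
          (\<forall>S. S \<subseteq> features M \<and> j \<notin> S \<and> k \<notin> S
               \<longrightarrow> f (S \<union> {j}) = f (S \<union> {k}))
          \<longrightarrow> layer1 M f j = layer1 M f k)
     \<and> (\<forall>f :: nat set \<Rightarrow> real.
          (\<Sum>i = 1..M. layer1 M f i) = f (features M) - f {})"
proof (intro conjI allI ballI impI)
  fix f :: "nat set \<Rightarrow> real" and j k
  assume "j \<in> features M" "k \<in> features M"
    and "\<forall>S. S \<subseteq> features M \<and> j \<notin> S \<and> k \<notin> S \<longrightarrow> f (S \<union> {j}) = f (S \<union> {k})"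
  then show "layer1 M f j = layer1 M f k"
    by (intro layer1_symmetric) auto
qed (rule layer1_linear layer1_efficient[OF assms])+

end
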